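(* Let $G$ be an arbitrary group that is generated by its elements of order $2$. Then there exists a commutative semigroup $S$ such that $G\cong \mathscr C(S)$.
   Context: For a semigroup $S$, an involution of $S$ is a function $\alpha:S\to S$ with $\alpha(xy)=\alpha(y)\alpha(x)$ and $\alpha(\alpha(x))=x$ for all $x,y\in S$, and $\alpha\neq \mathrm{id}_S$. The set of all involutions of $S$ is denoted $I(S)$, and $\mathscr C(S)=\langle I(S)\rangle$ is the subgroup of the symmetric group $\operatorname{Sym}(S)$ (all permutations of the set $S$) generated by $I(S)$; it is the trivial group $\{\mathrm{id}_S\}$ if $I(S)=\emptyset$. *)

theory Defs
  imports "HOL-Algebra.Algebra"
begin

text \<open>The library has semigroups only as a type class and as locales over a whole type, which
  cannot be quantified over existentially; hence the version with an explicit carrier.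
  As usual, semigroups are nonempty.

  The existence of a semigroup has to be stated with carrier inside a fixed type. For a group over
  \<open>'a\<close> we take \<open>'a \<times> nat\<close>, which has room for a semigroup of cardinality up to
  \<open>|G| \<cdot> \<aleph>\<^sub>0\<close>; this bound on the size of the semigroup only strengthens the
  existence claim.\<close>

locale semigroup_on =
  fixes S :: "'s set" and mul :: "'s \<Rightarrow> 's \<Rightarrow> 's"
  assumes nonempty: "S \<noteq> {}"
    and closed: "\<lbrakk>x \<in> S; y \<in> S\<rbrakk> \<Longrightarrow> mul x y \<in> S"
    and assoc: "\<lbrakk>x \<in> S; y \<in> S; z \<in> S\<rbrakk> \<Longrightarrow> mul (mul x y) z = mul x (mul y z)"

locale comm_semigroup_on = semigroup_on +
  assumes comm: "\<lbrakk>x \<in> S; y \<in> S\<rbrakk> \<Longrightarrow> mul x y = mul y x"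

text \<open>As in \<^const>\<open>Bij\<close>, a function on \<open>S\<close> is represented by its extension that is
  \<^const>\<open>undefined\<close> outside \<open>S\<close>, so that functions agreeing on \<open>S\<close> are equal.\<close>

definition involutions :: "'s set \<Rightarrow> ('s \<Rightarrow> 's \<Rightarrow> 's) \<Rightarrow> ('s \<Rightarrow> 's) set" where
  "involutions S mul = {\<alpha> \<in> S \<rightarrow>\<^sub>E S.
     (\<forall>x\<in>S. \<forall>y\<in>S. \<alpha> (mul x y) = mul (\<alpha> y) (\<alpha> x)) \<and>
     (\<forall>x\<in>S. \<alpha> (\<alpha> x) = x) \<and>
     \<alpha> \<noteq> (\<lambda>x\<in>S. x)}"

definition involution_group :: "'s set \<Rightarrow> ('s \<Rightarrow> 's \<Rightarrow> 's) \<Rightarrow> ('s \<Rightarrow> 's) monoid" where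
  "involution_group S mul = subgroup_generated (BijGroup S) (involutions S mul)"

lemma involutions_subset_Bij: "involutions S mul \<subseteq> carrier (BijGroup S)"
proof
  fix \<alpha> assume a: "\<alpha> \<in> involutions S mul"
  then have f: "\<alpha> \<in> S \<rightarrow> S" and i: "\<forall>x\<in>S. \<alpha> (\<alpha> x) = x" and e: "\<alpha> \<in> extensional S"
    by (auto simp: involutions_def PiE_def)
  have "bij_betw \<alpha> S S"
    using f i by (intro bij_betwI[where g = \<alpha>]) auto
  with e show "\<alpha> \<in> carrier (BijGroup S)"
    by (simp add: BijGroup_def Bij_def)
qed

lemma carrier_involution_group:
  "carrier (involution_group S mul) = generate (BijGroup S) (involutions S mul)"
  using involutions_subset_Bij[of S mul]
  by (simp add: involution_group_def carrier_subgroup_generated Int_absorb1)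

end

theory Submission
  imports Defs
begin

text \<open>Let \<open>T\<close> be the set of elements of order 2. The coloured Cayley graph of \<open>G\<close> with respect
  to \<open>T\<close> is undirected, because \<open>T\<close> consists of involutions, and its colour-preserving
  automorphisms are exactly the left translations. Encode it in a commutative semigroup in which
  all products of three elements are zero: \<open>g * h\<close> is the colour \<open>g\<^sup>-\<^sup>1 h\<close>
  if that lies in \<open>T\<close>, and zero otherwise. To make an involution fix the colours \<open>c\<^sub>t\<close>, add
  elements \<open>d\<^sub>t\<close> and let \<open>d\<^sub>s * d\<^sub>t\<close> be one of \<open>c\<^sub>s\<close>, \<open>c\<^sub>t\<close>, chosen independently of the order of
  \<open>s\<close> and \<open>t\<close>: an involution swapping \<open>d\<^sub>s\<close> and \<open>d\<^sub>t\<close> swaps \<open>c\<^sub>s\<close> and \<open>c\<^sub>t\<close>, but has to fix the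
  chosen one. Hence the involutions of the semigroup are the translations by elements of \<open>T\<close>.\<close>

text \<open>The choice is made from the unordered pair \<open>{a, b}\<close>, which yields symmetry
  without any order on the type.\<close>

definition pick :: "'b \<Rightarrow> 'b \<Rightarrow> 'b" where
  "pick a b = (SOME z. z \<in> {a, b})"

lemma pick_cases: "pick a b = a \<or> pick a b = b"
proof -
  have "pick a b \<in> {a, b}"
    unfolding pick_def by (rule someI[of _ a]) simp
  then show ?thesis by simp
qed

lemma pick_same [simp]: "pick a a = a"
  using pick_cases[of a a] by simp

lemma pick_commute: "pick a b = pick b a"
  by (simp add: pick_def insert_commute)

context group
begin

definition order_two :: "'a set" where
  "order_two = {x \<in> carrier G. ord x = 2}"

text \<open>The tags 0, 1, 2, 3 mark the elements of \<open>G\<close>, the \<open>d\<^sub>t\<close>, the \<open>c\<^sub>t\<close> and the zero.\<close>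

definition cay_carrier :: "('a \<times> nat) set" where
  "cay_carrier = carrier G \<times> {0} \<union> order_two \<times> {1, 2} \<union> {(\<one>, 3)}"

definition cay_mul :: "'a \<times> nat \<Rightarrow> 'a \<times> nat \<Rightarrow> 'a \<times> nat" where
  "cay_mul x y =
    (if snd x = 0 \<and> snd y = 0 \<and> inv (fst x) \<otimes> fst y \<in> order_two then (inv (fst x) \<otimes> fst y, 2)
     else if snd x = 1 \<and> snd y = 1 then (pick (fst x) (fst y), 2)
     else (\<one>, 3))"

definition cay_translation :: "'a \<Rightarrow> 'a \<times> nat \<Rightarrow> 'a \<times> nat" where
  "cay_translation g = (\<lambda>x\<in>cay_carrier. if snd x = 0 then (g \<otimes> fst x, 0) else x)"

lemma ord_eq_2_iff:
  assumes "x \<in> carrier G"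
  shows "ord x = 2 \<longleftrightarrow> x \<noteq> \<one> \<and> x \<otimes> x = \<one>"
proof -
  have sq: "x \<otimes> x = \<one> \<longleftrightarrow> ord x dvd 2"
    using assms pow_eq_id[of x 2] by (simp add: numeral_2_eq_2)
  have "ord x dvd 2 \<longleftrightarrow> ord x = 1 \<or> ord x = 2"
    using two_is_prime_nat by (auto simp: prime_nat_iff)
  with sq show ?thesis
    using ord_eq_1[OF assms] by auto
qed

lemma order_two_iff: "x \<in> order_two \<longleftrightarrow> x \<in> carrier G \<and> x \<noteq> \<one> \<and> x \<otimes> x = \<one>"
  by (auto simp: order_two_def ord_eq_2_iff)

lemma inv_order_two: "x \<in> order_two \<Longrightarrow> inv x = x"
  by (simp add: order_two_iff inv_equality)

section \<open>The commutative semigroup of the Cayley graph\<close>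

lemma cay_mul_closed:
  assumes "x \<in> cay_carrier" "y \<in> cay_carrier"
  shows "cay_mul x y \<in> cay_carrier"
  using assms pick_cases[of "fst x" "fst y"]
  by (auto simp: cay_mul_def cay_carrier_def)

text \<open>\<open>inv b \<otimes> a\<close> is the inverse of \<open>inv a \<otimes> b\<close>, and
  an element of order 2 is its own inverse, so both directions of an edge carry the same
  colour.\<close>

lemma cay_mul_comm:
  assumes "x \<in> cay_carrier" "y \<in> cay_carrier"
  shows "cay_mul x y = cay_mul y x"
proof -
  have flip: "inv b \<otimes> a = inv a \<otimes> b"
    if "a \<in> carrier G" "b \<in> carrier G" "inv a \<otimes> b \<in> order_two" for a b
  proof -
    have "inv (inv a \<otimes> b) = inv b \<otimes> a"
      using that by (simp add: inv_mult_group)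
    then show ?thesis
      using inv_order_two[OF that(3)] by simp
  qed
  consider a b where "x = (a, 0)" "y = (b, 0)" "a \<in> carrier G" "b \<in> carrier G"
    | "snd x \<noteq> 0 \<or> snd y \<noteq> 0"
    using assms by (auto simp: cay_carrier_def)
  then show ?thesis
  proof cases
    case 1
    then consider "inv b \<otimes> a = inv a \<otimes> b"
      | "inv a \<otimes> b \<notin> order_two" "inv b \<otimes> a \<notin> order_two"
      using flip by metis
    then show ?thesis
      using 1 by cases (simp_all add: cay_mul_def)
  next
    case 2
    then show ?thesis
      by (auto simp: cay_mul_def pick_commute)
  qed
qed

text \<open>Products have tag 2 or 3, and elements with these tags annihilate everything.
  Associativity is then immediate.\<close>

lemma cay_mul_mul:
  "cay_mul (cay_mul x y) z = (\<one>, 3)" "cay_mul x (cay_mul y z) = (\<one>, 3)"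
  by (simp_all add: cay_mul_def)

lemma comm_semigroup_cay: "comm_semigroup_on cay_carrier cay_mul"
proof
  show "cay_carrier \<noteq> {}"
    by (simp add: cay_carrier_def)
qed (simp_all add: cay_mul_closed cay_mul_mul cay_mul_comm)

section \<open>Left translations as automorphisms\<close>

lemma cay_translation_closed:
  assumes "g \<in> carrier G" "x \<in> cay_carrier"
  shows "cay_translation g x \<in> cay_carrier"
  using assms by (auto simp: cay_translation_def cay_carrier_def)

lemma cay_translation_one: "cay_translation \<one> = (\<lambda>x\<in>cay_carrier. x)"
  by (rule ext) (auto simp: cay_translation_def cay_carrier_def)

lemma cay_translation_mult:
  assumes "g \<in> carrier G" "h \<in> carrier G" "x \<in> cay_carrier"
  shows "cay_translation (g \<otimes> h) x = cay_translation g (cay_translation h x)"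
  using assms by (auto simp: cay_translation_def cay_carrier_def m_assoc)

text \<open>Left translation does not change the quotient \<open>inv a \<otimes> b\<close>, and it
  fixes every product because it moves only elements of tag 0.\<close>

lemma cay_translation_mul:
  assumes "g \<in> carrier G" "x \<in> cay_carrier" "y \<in> cay_carrier"
  shows "cay_translation g (cay_mul x y) = cay_mul (cay_translation g x) (cay_translation g y)"
proof -
  have *: "inv (g \<otimes> a) \<otimes> (g \<otimes> b) = inv a \<otimes> b" if "a \<in> carrier G" "b \<in> carrier G" for a b
  proof -
    have "inv (g \<otimes> a) \<otimes> (g \<otimes> b) = inv a \<otimes> (inv g \<otimes> (g \<otimes> b))"
      using that assms(1) by (simp add: inv_mult_group m_assoc)
    also have "inv g \<otimes> (g \<otimes> b) = b"
      using that assms(1) by (simp add: m_assoc[symmetric])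
    finally show ?thesis .
  qed
  have "cay_translation g (cay_mul x y) = cay_mul x y"
    using cay_mul_closed[OF assms(2,3)] by (simp add: cay_translation_def cay_mul_def)
  also have "\<dots> = cay_mul (cay_translation g x) (cay_translation g y)"
    using assms * by (auto simp: cay_translation_def cay_carrier_def cay_mul_def)
  finally show ?thesis .
qed

lemma cay_translation_inj:
  assumes "g \<in> carrier G" "h \<in> carrier G" "cay_translation g = cay_translation h"
  shows "g = h"
  using fun_cong[OF assms(3), of "(\<one>, 0)"] assms(1,2)
  by (simp add: cay_translation_def cay_carrier_def)

lemma cay_translation_hom: "cay_translation \<in> hom G (BijGroup cay_carrier)"
proof (rule homI)
  show bij: "cay_translation g \<in> carrier (BijGroup cay_carrier)" if "g \<in> carrier G" for g
  proof -
    have "bij_betw (cay_translation g) cay_carrier cay_carrier"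
    proof (rule bij_betwI[where g = "cay_translation (inv g)"])
      show "cay_translation (inv g) (cay_translation g x) = x" if "x \<in> cay_carrier" for x
        using cay_translation_mult[of "inv g" g x] \<open>g \<in> carrier G\<close> that
        by (simp add: cay_translation_one)
      show "cay_translation g (cay_translation (inv g) x) = x" if "x \<in> cay_carrier" for x
        using cay_translation_mult[of g "inv g" x] \<open>g \<in> carrier G\<close> that
        by (simp add: cay_translation_one)
    qed (use that cay_translation_closed in auto)
    then show ?thesis
      by (simp add: BijGroup_def Bij_def cay_translation_def)
  qed
  show "cay_translation (g \<otimes> h) = cay_translation g \<otimes>\<^bsub>BijGroup cay_carrier\<^esub> cay_translation h"
    if "g \<in> carrier G" "h \<in> carrier G" for g h
  proof -
    have "cay_translation (g \<otimes> h) = compose cay_carrier (cay_translation g) (cay_translation h)"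
    proof (rule extensionalityI[of _ cay_carrier])
      show "cay_translation (g \<otimes> h) x = compose cay_carrier (cay_translation g) (cay_translation h) x"
        if "x \<in> cay_carrier" for x
        using that \<open>g \<in> carrier G\<close> \<open>h \<in> carrier G\<close>
        by (simp add: compose_eq cay_translation_mult)
    qed (simp_all add: cay_translation_def)
    then show ?thesis
      using bij[OF that(1)] bij[OF that(2)] by (simp add: BijGroup_def)
  qed
qed

lemma cay_translation_involution:
  assumes "g \<in> order_two"
  shows "cay_translation g \<in> involutions cay_carrier cay_mul"
proof -
  have g: "g \<in> carrier G" "g \<noteq> \<one>" "g \<otimes> g = \<one>"
    using assms by (auto simp: order_two_iff)
  have "cay_translation g \<in> cay_carrier \<rightarrow>\<^sub>E cay_carrier"
    using g(1) cay_translation_closed by (auto simp: cay_translation_def)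
  moreover have "cay_translation g (cay_mul x y) = cay_mul (cay_translation g y) (cay_translation g x)"
    if "x \<in> cay_carrier" "y \<in> cay_carrier" for x y
    using that g(1) by (simp add: cay_translation_mul cay_mul_comm cay_translation_closed)
  moreover have "cay_translation g (cay_translation g x) = x" if "x \<in> cay_carrier" for x
    using cay_translation_mult[of g g x] g that by (simp add: cay_translation_one)
  moreover have "cay_translation g \<noteq> (\<lambda>x\<in>cay_carrier. x)"
    using cay_translation_inj[of g \<one>] g by (auto simp: cay_translation_one)
  ultimately show ?thesis
    by (simp add: involutions_def)
qed

section \<open>Every involution is a left translation\<close>

lemma involution_is_cay_translation:
  assumes gen: "generate G order_two = carrier G"
    and inv: "\<phi> \<in> involutions cay_carrier cay_mul"
  shows "\<exists>g\<in>order_two. \<phi> = cay_translation g"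
proof -
  have ext: "\<phi> \<in> extensional cay_carrier"
    using inv by (auto simp: involutions_def PiE_def)
  have closed: "\<phi> x \<in> cay_carrier" if "x \<in> cay_carrier" for x
    using inv that by (auto simp: involutions_def)
  \<comment> \<open>Commutativity turns the anti-homomorphism into a homomorphism.\<close>
  have mul: "\<phi> (cay_mul x y) = cay_mul (\<phi> x) (\<phi> y)"
    if "x \<in> cay_carrier" "y \<in> cay_carrier" for x y
    using inv that closed cay_mul_comm[of "\<phi> x" "\<phi> y"] by (auto simp: involutions_def)
  have invol: "\<phi> (\<phi> x) = x" if "x \<in> cay_carrier" for x
    using inv that by (auto simp: involutions_def)
  have nontrivial: "\<phi> \<noteq> (\<lambda>x\<in>cay_carrier. x)"
    using inv by (auto simp: involutions_def)

  have zero_in: "(\<one>, 3) \<in> cay_carrier"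
    by (simp add: cay_carrier_def)
  \<comment> \<open>Zero times its image is zero; applying \<open>\<phi>\<close> to this product
    gives a product with the factor \<open>\<phi> (\<phi> (\<one>, 3))\<close>, which is zero
    again.\<close>
  have zero: "\<phi> (\<one>, 3) = (\<one>, 3)"
    using mul[OF zero_in closed[OF zero_in]] invol[OF zero_in]
    by (simp add: cay_mul_def)

  \<comment> \<open>Only elements of tag 1 have a nonzero square, since \<open>\<one>\<close> does
    not have order 2; the square of \<open>(t, 1)\<close> is \<open>(t, 2)\<close>, whose image is
    nonzero.\<close>
  have swap: "\<exists>u\<in>order_two. \<phi> (t, 1) = (u, 1) \<and> \<phi> (t, 2) = (u, 2)" if t: "t \<in> order_two" for t
  proof -
    have in_S: "(t, 1) \<in> cay_carrier" "(t, 2) \<in> cay_carrier"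
      using t by (auto simp: cay_carrier_def)
    have sq: "cay_mul (\<phi> (t, 1)) (\<phi> (t, 1)) = \<phi> (t, 2)"
      using mul[OF in_S(1) in_S(1)] by (simp add: cay_mul_def)
    have "\<phi> (t, 2) \<noteq> (\<one>, 3)"
      using invol[OF in_S(2)] zero by auto
    then show ?thesis
      using sq closed[OF in_S(1)]
      by (auto simp: cay_mul_def cay_carrier_def order_two_iff split: if_splits)
  qed

  have fixed: "\<phi> (t, 1) = (t, 1) \<and> \<phi> (t, 2) = (t, 2)" if t: "t \<in> order_two" for t
  proof -
    obtain u where u: "u \<in> order_two" "\<phi> (t, 1) = (u, 1)" "\<phi> (t, 2) = (u, 2)"
      using swap[OF t] by blast
    have in_S: "(v, i) \<in> cay_carrier" if "v \<in> {t, u}" "i \<in> {1, 2}" for v i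
      using that t u(1) by (auto simp: cay_carrier_def)
    have swap_back: "\<phi> (u, 1) = (t, 1)" "\<phi> (u, 2) = (t, 2)"
      using invol[of "(t, 1)"] invol[of "(t, 2)"] in_S u by auto
    have "\<phi> (pick t u, 2) = (pick t u, 2)"
      using mul[of "(t, 1)" "(u, 1)"] in_S u swap_back
      by (simp add: cay_mul_def pick_commute)
    then have "u = t"
      using pick_cases[of t u] u swap_back by auto
    with u show ?thesis by simp
  qed

  define f where "f g = fst (\<phi> (g, 0))" for g
  have f: "f g \<in> carrier G \<and> \<phi> (g, 0) = (f g, 0)" if g: "g \<in> carrier G" for g
  proof -
    have in_S: "(g, 0) \<in> cay_carrier"
      using g by (simp add: cay_carrier_def)
    \<comment> \<open>An image of nonzero tag would be a fixed point, whereas \<open>\<phi>\<close>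
      sends it back to \<open>(g, 0)\<close>.\<close>
    have "\<phi> (\<phi> (g, 0)) \<noteq> \<phi> (g, 0)" if "snd (\<phi> (g, 0)) \<noteq> 0"
      using that invol[OF in_S] by auto
    moreover have "\<phi> x = x" if "x \<in> cay_carrier" "snd x \<noteq> 0" for x
      using that fixed zero by (auto simp: cay_carrier_def)
    ultimately have "snd (\<phi> (g, 0)) = 0"
      using closed[OF in_S] by blast
    then show ?thesis
      using closed[OF in_S] by (auto simp: f_def cay_carrier_def)
  qed

  have f_edge: "f (x \<otimes> t) = f x \<otimes> t" if "x \<in> carrier G" "t \<in> order_two" for x t
  proof -
    have t: "t \<in> carrier G"
      using that by (simp add: order_two_iff)
    have div: "inv x \<otimes> (x \<otimes> t) = t"
      using that t by (simp add: m_assoc[symmetric])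
    \<comment> \<open>The edge of colour \<open>t\<close> from \<open>x\<close> to
      \<open>x \<otimes> t\<close> goes to an edge of the same colour, as colours are fixed.\<close>
    have "cay_mul (f x, 0) (f (x \<otimes> t), 0) = (t, 2)"
      using mul[of "(x, 0)" "(x \<otimes> t, 0)"] that t f fixed div
      by (simp add: cay_carrier_def cay_mul_def)
    then have "inv (f x) \<otimes> f (x \<otimes> t) = t"
      by (auto simp: cay_mul_def split: if_splits)
    then show ?thesis
      using that t f by (metis inv_solve_left m_closed)
  qed
  \<comment> \<open>This follows a path of edges in the Cayley graph. The start \<open>x\<close>
    stays arbitrary because in a product the factor \<open>h2\<close> acts at
    \<open>x \<otimes> h1\<close>.\<close>
  have f_mult: "f (x \<otimes> h) = f x \<otimes> h" if "h \<in> generate G order_two" "x \<in> carrier G" for x h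
    using that
  proof (induction arbitrary: x rule: generate.induct)
    case one
    then show ?case using f by simp
  next
    case (incl h)
    then show ?case using f_edge by simp
  next
    case (inv h)
    then show ?case using f_edge by (simp add: inv_order_two)
  next
    case (eng h1 h2)
    then show ?case using f gen by (simp add: m_assoc[symmetric])
  qed

  define g where "g = f \<one>"
  have g: "g \<in> carrier G"
    using f by (simp add: g_def)
  have on_G: "\<phi> (h, 0) = (g \<otimes> h, 0)" if "h \<in> carrier G" for h
    using f_mult[of h \<one>] f[OF that] that gen by (simp add: g_def)
  have "\<phi> x = cay_translation g x" for x
  proof (cases "x \<in> cay_carrier")
    case True
    then show ?thesis
      using fixed zero on_G by (auto simp: cay_carrier_def cay_translation_def)
  next
    case False
    then show ?thesis
      using extensional_arb[OF ext] by (simp add: cay_translation_def)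
  qed
  then have eq: "\<phi> = cay_translation g" ..
  have "(\<one>, 0) \<in> cay_carrier"
    by (simp add: cay_carrier_def)
  then have "g \<otimes> g = \<one>"
    using invol[of "(\<one>, 0)"] on_G g by simp
  moreover have "g \<noteq> \<one>"
    using nontrivial eq cay_translation_one by auto
  ultimately show ?thesis
    using g eq by (auto simp: order_two_iff)
qed

text \<open>A homomorphism maps the subgroup generated by a set onto the one generated by its image,
  and the involutions are exactly the image of \<open>order_two\<close>.\<close>

lemma iso_involution_group_cay:
  assumes gen: "generate G order_two = carrier G"
  shows "cay_translation \<in> iso G (involution_group cay_carrier cay_mul)"
proof -
  have inv: "involutions cay_carrier cay_mul = cay_translation ` order_two"
    using involution_is_cay_translation[OF gen] cay_translation_involution by blast
  interpret h: group_hom G "BijGroup cay_carrier" cay_translation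
    using cay_translation_hom group_BijGroup
    by (intro group_hom.intro group_hom_axioms.intro is_group)
  have "carrier (involution_group cay_carrier cay_mul) = cay_translation ` carrier G"
    using h.generate_img[of order_two] gen
    by (simp add: carrier_involution_group inv order_two_def)
  moreover have "cay_translation \<in> hom G (involution_group cay_carrier cay_mul)"
    using cay_translation_hom calculation by (auto simp: hom_def involution_group_def)
  moreover have "inj_on cay_translation (carrier G)"
    using cay_translation_inj by (auto intro: inj_onI)
  ultimately show ?thesis
    by (simp add: iso_def bij_betw_def)
qed

end

theorem theorem3p1:
  fixes G :: "('a, 'b) monoid_scheme"
  assumes "group G"
    and "generate G {x \<in> carrier G. group.ord G x = 2} = carrier G"
  shows "\<exists>(S :: ('a \<times> nat) set) mul. comm_semigroup_on S mul \<and> G \<cong> involution_group S mul"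
proof -
  interpret group G by fact
  have "generate G order_two = carrier G"
    using assms(2) by (simp add: order_two_def)
  then show ?thesis
    using comm_semigroup_cay iso_involution_group_cay is_isoI by blast
qed

end
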